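(* Let $\hat A=A_s+A_d\epsilon\in\mathbb{DQ}^{n\times n}$, let $\lambda_{1s},\dots,\lambda_{ms}\in\mathbb C$ be the distinct standard eigenvalues of $A_s$ with algebraic multiplicities $n_1,\dots,n_m$, and let $P_s\in\mathbb Q^{n\times n}$ be an invertible matrix with $$P_s^{-1}A_sP_s=\mathrm{diag}(J_1,\dots,J_m),$$ where $J_i\in\mathbb Q^{n_i\times n_i}$ is the direct sum of all Jordan blocks of $A_s$ with eigenvalue $\lambda_{is}$. Then there exist a dual quaternion matrix $\hat P=P_s+P_d\epsilon\in\mathbb{DQ}^{n\times n}$ and matrices $H_i\in\mathbb Q^{n_i\times n_i}$, $i=1,\dots,m$, such that $$\hat P^{-1}\hat A\hat P=\mathrm{diag}\bigl(J_1+H_1\epsilon,\;J_2+H_2\epsilon,\;\dots,\;J_m+H_m\epsilon\bigr).$$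
   Context: $\mathbb{Q}$ denotes the quaternions and $\mathbb{DQ}$ the dual quaternions $q_s+q_d\epsilon$, $q_s,q_d\in\mathbb Q$, where $\epsilon\ne0$, $\epsilon^2=0$ and $\epsilon$ commutes with quaternions. A dual quaternion matrix is written $\hat A=A_s+A_d\epsilon$ with quaternion matrices $A_s$ (standard part) and $A_d$ (dual part); it is invertible iff $A_s$ is. $\lambda\in\mathbb Q$ is a (right) eigenvalue of $A\in\mathbb Q^{n\times n}$ if $A\mathbf x=\mathbf x\lambda$ for some nonzero $\mathbf x\in\mathbb Q^n$; it is a standard eigenvalue if it is a complex number with nonnegative imaginary part. It is known that every $A\in\mathbb Q^{n\times n}$ is similar, via an invertible quaternion matrix, to a block diagonal matrix of (upper) Jordan blocks whose diagonal entries are the standard eigenvalues of $A$, unique up to the order of blocks. The algebraic multiplicity of a standard eigenvalue is the sum of the sizes of its Jordan blocks. *)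

theory Defs
  imports Complex_Main "Jordan_Normal_Form.Jordan_Normal_Form"
begin

datatype quat = Quat (qre: real) (qi: real) (qj: real) (qk: real)

instantiation quat :: division_ring
begin

definition "0 = Quat 0 0 0 0"
definition "1 = Quat 1 0 0 0"
definition "x + y = Quat (qre x + qre y) (qi x + qi y) (qj x + qj y) (qk x + qk y)"
definition "- x = Quat (- qre x) (- qi x) (- qj x) (- qk x)"
definition "x - y = Quat (qre x - qre y) (qi x - qi y) (qj x - qj y) (qk x - qk y)"
definition "x * y = Quat
  (qre x * qre y - qi x * qi y - qj x * qj y - qk x * qk y)
  (qre x * qi y + qi x * qre y + qj x * qk y - qk x * qj y)
  (qre x * qj y - qi x * qk y + qj x * qre y + qk x * qi y)
  (qre x * qk y + qi x * qj y - qj x * qi y + qk x * qre y)"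
definition "inverse x =
  (let N = (qre x)\<^sup>2 + (qi x)\<^sup>2 + (qj x)\<^sup>2 + (qk x)\<^sup>2
   in Quat (qre x / N) (- qi x / N) (- qj x / N) (- qk x / N))"
definition "x div (y :: quat) = x * inverse y"

lemmas quat_defs = zero_quat_def one_quat_def plus_quat_def uminus_quat_def
  minus_quat_def times_quat_def

instance
proof
  fix a b c :: quat
  show "a + b + c = a + (b + c)" "a + b = b + a" "0 + a = a" "- a + a = 0"
    "a - b = a + - b" "1 * a = a" "a * 1 = a" "(0 :: quat) \<noteq> 1"
    by (simp_all add: quat_defs)
  show "a * b * c = a * (b * c)" "(a + b) * c = a * c + b * c" "a * (b + c) = a * b + a * c"
    by (simp_all add: quat_defs algebra_simps)
  show "inverse (0 :: quat) = 0"
    by (simp add: zero_quat_def inverse_quat_def)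
  show "a div b = a * inverse b"
    by (simp add: divide_quat_def)
  assume a: "a \<noteq> 0"
  define N where "N = (qre a)\<^sup>2 + (qi a)\<^sup>2 + (qj a)\<^sup>2 + (qk a)\<^sup>2"
  have N: "N \<noteq> 0"
  proof
    assume "N = 0"
    then have "qre a = 0 \<and> qi a = 0 \<and> qj a = 0 \<and> qk a = 0"
      unfolding N_def by (simp add: add_nonneg_eq_0_iff)
    with a show False
      by (cases a) (simp add: zero_quat_def)
  qed
  have "qre a * qre a / N + qi a * qi a / N + qj a * qj a / N + qk a * qk a / N = 1"
    using N by (simp add: N_def power2_eq_square flip: add_divide_distrib)
  then show "inverse a * a = 1" "a * inverse a = 1"
    by (simp_all add: inverse_quat_def one_quat_def times_quat_def Let_def
        mult.commute flip: N_def)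
qed

end

definition quat_of_complex :: "complex \<Rightarrow> quat" where
  "quat_of_complex z = Quat (Re z) (Im z) 0 0"

datatype dquat = DQuat (st_part: quat) (du_part: quat)

instantiation dquat :: ring_1
begin

definition "0 = DQuat 0 0"
definition "1 = DQuat 1 0"
definition "x + y = DQuat (st_part x + st_part y) (du_part x + du_part y)"
definition "- x = DQuat (- st_part x) (- du_part x)"
definition "x - y = DQuat (st_part x - st_part y) (du_part x - du_part y)"
definition "x * y = DQuat (st_part x * st_part y)
  (st_part x * du_part y + du_part x * st_part y)"

lemmas dquat_defs = zero_dquat_def one_dquat_def plus_dquat_def uminus_dquat_def
  minus_dquat_def times_dquat_def

instance
  by standard (simp_all add: dquat_defs algebra_simps)

end

definition dquat_of_quat :: "quat \<Rightarrow> dquat" where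
  "dquat_of_quat q = DQuat q 0"

definition dq_eps :: dquat where
  "dq_eps = DQuat 0 1"

lemma dq_eps_nonzero: "dq_eps \<noteq> 0"
  and dq_eps_square: "dq_eps * dq_eps = 0"
  and dq_eps_commute: "dq_eps * dquat_of_quat q = dquat_of_quat q * dq_eps"
  and DQuat_conv: "DQuat a b = dquat_of_quat a + dquat_of_quat b * dq_eps"
  by (simp_all add: dq_eps_def dquat_of_quat_def dquat_defs)

text \<open>The dual quaternion matrix $A_s + A_d\epsilon$.  Since $\epsilon$ is central, the
  library's left scalar multiple $\epsilon A_d$ is $A_d\epsilon$.\<close>

definition dual_mat :: "quat mat \<Rightarrow> quat mat \<Rightarrow> dquat mat" where
  "dual_mat A\<^sub>s A\<^sub>d = map_mat dquat_of_quat A\<^sub>s + dq_eps \<cdot>\<^sub>m map_mat dquat_of_quat A\<^sub>d"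

lemma dual_mat_index:
  assumes "A\<^sub>s \<in> carrier_mat n k" "A\<^sub>d \<in> carrier_mat n k" "i < n" "j < k"
  shows "dual_mat A\<^sub>s A\<^sub>d $$ (i, j) = DQuat (A\<^sub>s $$ (i, j)) (A\<^sub>d $$ (i, j))"
  using assms by (simp add: dual_mat_def dq_eps_commute DQuat_conv)

definition right_eigenvalue :: "quat mat \<Rightarrow> quat \<Rightarrow> bool" where
  "right_eigenvalue A q \<longleftrightarrow>
     (\<exists>x \<in> carrier_vec (dim_row A). x \<noteq> 0\<^sub>v (dim_row A) \<and> A *\<^sub>v x = map_vec (\<lambda>c. c * q) x)"

definition standard_eigenvalue :: "quat mat \<Rightarrow> complex \<Rightarrow> bool" where
  "standard_eigenvalue A z \<longleftrightarrow> right_eigenvalue A (quat_of_complex z) \<and> Im z \<ge> 0"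

definition quat_jordan_matrix :: "(nat \<times> complex) list \<Rightarrow> quat mat" where
  "quat_jordan_matrix bs = jordan_matrix (map (\<lambda>(k, z). (k, quat_of_complex z)) bs)"

text \<open>\<open>bs\<close> lists the (size, eigenvalue) pairs of the Jordan blocks of \<open>A\<close>, in an arbitrary
  order.  Empty blocks are excluded, so \<open>bs\<close> is unique up to permutation.\<close>

definition is_jordan_form :: "quat mat \<Rightarrow> (nat \<times> complex) list \<Rightarrow> bool" where
  "is_jordan_form A bs \<longleftrightarrow>
     (\<forall>(k, z) \<in> set bs. k > 0 \<and> standard_eigenvalue A z) \<and>
     similar_mat A (quat_jordan_matrix bs)"

text \<open>Well defined because of the existence and the uniqueness (up to the order of the blocks)
  of the quaternion Jordan form.\<close>

definition algebraic_multiplicity :: "quat mat \<Rightarrow> complex \<Rightarrow> nat" where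
  "algebraic_multiplicity A z =
     (THE k. \<exists>bs. is_jordan_form A bs \<and> k = sum_list (map fst (filter (\<lambda>b. snd b = z) bs)))"

text \<open>The blocks in \<open>J\<close> may come in any order because those in \<open>bs\<close> may.\<close>

definition is_jordan_part :: "quat mat \<Rightarrow> complex \<Rightarrow> quat mat \<Rightarrow> bool" where
  "is_jordan_part A z J \<longleftrightarrow>
     (\<exists>bs. is_jordan_form A bs \<and> J = quat_jordan_matrix (filter (\<lambda>b. snd b = z) bs))"

end

theory Submission
  imports Defs
begin

text \<open>Conjugating first by $P_s$ replaces $\hat A$ by $T + B\epsilon$, where $T$ is the block
  diagonal Jordan form of $A_s$ and $B = P_s^{-1} A_d P_s$. A second conjugation, by
  $1 + X\epsilon$ with inverse $1 - X\epsilon$, leaves $T$ alone and replaces $B$ by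
  $TX + B - XT$ (\<open>dual_mat_conjugate\<close>). So $\hat P = P_s(1 + X\epsilon)$ works as soon as
  $X$ is chosen such that $TX - XT$ cancels all entries of $B$ outside the diagonal blocks; what
  remains inside the blocks are the $H_i$.

  Such an $X$ exists because $T$ is upper triangular. The $(a,b)$ entry of the matrix equation is the
  scalar equation $t_{aa} x - x t_{bb} = c$ for $x = x_{ab}$, whose right-hand side involves only
  entries of $X$ further down in the same column or further left in the same row. The entries can
  therefore be found one after the other, wherever the scalar equation is solvable for every $c$
  (\<open>upper_triangular_commutator_eliminates\<close>).

  Over the quaternions, with $t_{aa} = z$ and $t_{bb} = w$ complex, the scalar equation is
  solvable for every $c$ if $z$ is neither $w$ nor its conjugate. Between different blocks
  this holds because $z$ and $w$ are then distinct standard eigenvalues and both lie in the closed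
  upper half plane; this is where eigenvalues have to be standard
  (\<open>surj_sylvester_upper_half_plane\<close>).\<close>

section \<open>The equation $qx - xr = c$ over the quaternions\<close>

text \<open>Write $x = u + v j$ with $u, v$ complex. Since $j w = \bar w j$, the equation splits into
  $(z - w) u = c_1$ and $(z - \bar w) v = c_2$, where $c = c_1 + c_2 j$.\<close>

lemma surj_sylvester_quat_of_complex:
  assumes "z \<noteq> w" "z \<noteq> cnj w"
  shows "surj (\<lambda>x. quat_of_complex z * x - x * quat_of_complex w)"
proof (rule surjI)
  fix c
  define u where "u = Complex (qre c) (qi c) / (z - w)"
  define v where "v = Complex (qj c) (qk c) / (z - cnj w)"
  have u: "(z - w) * u = Complex (qre c) (qi c)"
    and v: "(z - cnj w) * v = Complex (qj c) (qk c)"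
    using assms by (simp_all add: u_def v_def)
  show "quat_of_complex z * Quat (Re u) (Im u) (Re v) (Im v)
      - Quat (Re u) (Im u) (Re v) (Im v) * quat_of_complex w = c"
    using u v by (cases c) (auto simp: quat_defs quat_of_complex_def complex_eq_iff algebra_simps)
qed

corollary surj_sylvester_upper_half_plane:
  assumes "z \<noteq> w" "Im z \<ge> 0" "Im w \<ge> 0"
  shows "surj (\<lambda>x. quat_of_complex z * x - x * quat_of_complex w)"
proof (rule surj_sylvester_quat_of_complex)
  show "z \<noteq> cnj w"
    using assms by (auto simp: complex_eq_iff)
qed (fact assms)

section \<open>The Sylvester equation for a triangular matrix\<close>

lemma upper_triangular_mult_index:
  fixes T X :: "'a :: semiring_0 mat"
  assumes "T \<in> carrier_mat n n" "X \<in> carrier_mat n k" "upper_triangular T" "a < n" "b < k"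
  shows "(T * X) $$ (a, b) = T $$ (a, a) * X $$ (a, b) + (\<Sum>c\<in>{a<..<n}. T $$ (a, c) * X $$ (c, b))"
proof -
  have "(T * X) $$ (a, b) = (\<Sum>c\<in>{0..<n}. T $$ (a, c) * X $$ (c, b))"
    using assms by (simp add: scalar_prod_def)
  also have "\<dots> = (\<Sum>c\<in>{a..<n}. T $$ (a, c) * X $$ (c, b))"
    using assms upper_triangularD[OF assms(3), of _ a] by (intro sum.mono_neutral_right) auto
  also have "{a..<n} = insert a {a<..<n}"
    using assms by auto
  finally show ?thesis
    by simp
qed

lemma mult_upper_triangular_index:
  fixes T X :: "'a :: semiring_0 mat"
  assumes "T \<in> carrier_mat n n" "X \<in> carrier_mat k n" "upper_triangular T" "a < k" "b < n"
  shows "(X * T) $$ (a, b) = X $$ (a, b) * T $$ (b, b) + (\<Sum>c<b. X $$ (a, c) * T $$ (c, b))"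
proof -
  have "(X * T) $$ (a, b) = (\<Sum>c\<in>{0..<n}. X $$ (a, c) * T $$ (c, b))"
    using assms by (simp add: scalar_prod_def)
  also have "\<dots> = (\<Sum>c\<in>{..b}. X $$ (a, c) * T $$ (c, b))"
  proof (rule sum.mono_neutral_right)
    show "\<forall>c\<in>{0..<n} - {..b}. X $$ (a, c) * T $$ (c, b) = 0"
      using assms by (auto simp: upper_triangularD[OF assms(3), of b])
  qed (use assms in auto)
  also have "{..b} = insert b {..<b}"
    by auto
  finally show ?thesis
    by simp
qed

text \<open>The entries $x_{ab}$ are found by well-founded recursion: since $T$ is upper triangular, all terms
  of the $(a,b)$ entry other than $t_{aa} x_{ab} - x_{ab} t_{bb}$ involve only entries of $X$ below
  or to the left of $x_{ab}$. Where the scalar equation is not always solvable, $x_{ab}$ is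
  arbitrary; in the application these are the entries inside the diagonal blocks.\<close>

lemma upper_triangular_commutator_eliminates:
  fixes T B :: "'a :: ring mat"
  assumes T: "T \<in> carrier_mat n n" "upper_triangular T" and B: "B \<in> carrier_mat n n"
  shows "\<exists>X \<in> carrier_mat n n. \<forall>a<n. \<forall>b<n.
    surj (\<lambda>x. T $$ (a, a) * x - x * T $$ (b, b)) \<longrightarrow> (T * X + B - X * T) $$ (a, b) = 0"
proof -
  define rest where "rest f p = (case p of (a, b) \<Rightarrow> B $$ (a, b)
      + (\<Sum>c\<in>{a<..<n}. T $$ (a, c) * f (c, b)) - (\<Sum>c<b. f (a, c) * T $$ (c, b)))"
    for f :: "nat \<times> nat \<Rightarrow> 'a" and p
  let ?solves = "\<lambda>f (a, b) x. surj (\<lambda>x. T $$ (a, a) * x - x * T $$ (b, b)) \<longrightarrow>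
      T $$ (a, a) * x - x * T $$ (b, b) = - rest f (a, b)"
  \<comment> \<open>\<open>rest f (a, b)\<close> reads \<open>f\<close> only at \<open>(c, b)\<close> with \<open>a < c < n\<close> and at \<open>(a, c)\<close> with \<open>c < b\<close>;
    both steps decrease this measure.\<close>
  let ?R = "measure (\<lambda>(a, b). (n - a) + b)"
  have "\<exists>f. \<forall>p. ?solves f p (f p)"
  proof (rule dependent_wf_choice[of ?R])
    fix f g :: "nat \<times> nat \<Rightarrow> 'a" and p x
    assume "\<And>q. (q, p) \<in> ?R \<Longrightarrow> f q = g q"
    then have "rest f p = rest g p"
      by (cases p) (auto simp: rest_def intro!: arg_cong2[where f = "(-)"] arg_cong2[where f = "(+)"] sum.cong)
    then show "?solves f p x = ?solves g p x"
      by (cases p) simp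
  next
    fix p and f :: "nat \<times> nat \<Rightarrow> 'a"
    show "\<exists>x. ?solves f p x"
      by (auto split: prod.split dest!: surjD[where y = "- rest f p"])
  qed simp
  then obtain f where "\<forall>p. ?solves f p (f p)" ..
  then have f: "T $$ (a, a) * f (a, b) - f (a, b) * T $$ (b, b) = - rest f (a, b)"
    if "surj (\<lambda>x. T $$ (a, a) * x - x * T $$ (b, b))" for a b
    using that by (drule_tac spec[of _ "(a, b)"]) simp
  show ?thesis
  proof (intro bexI allI impI)
    show X: "mat n n f \<in> carrier_mat n n"
      by simp
    fix a b
    assume ab: "a < n" "b < n" and s: "surj (\<lambda>x. T $$ (a, a) * x - x * T $$ (b, b))"
    have "(T * mat n n f + B - mat n n f * T) $$ (a, b) =
        (T * mat n n f) $$ (a, b) + B $$ (a, b) - (mat n n f * T) $$ (a, b)"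
      using T(1) B ab by (simp del: index_mult_mat(1))
    also have "(T * mat n n f) $$ (a, b) =
        T $$ (a, a) * f (a, b) + (\<Sum>c\<in>{a<..<n}. T $$ (a, c) * f (c, b))"
      using ab by (subst upper_triangular_mult_index[OF T(1) X T(2) ab]) simp
    also have "(mat n n f * T) $$ (a, b) =
        f (a, b) * T $$ (b, b) + (\<Sum>c<b. f (a, c) * T $$ (c, b))"
      using ab by (subst mult_upper_triangular_index[OF T(1) X T(2) ab]) simp
    also have "T $$ (a, a) * f (a, b) + (\<Sum>c\<in>{a<..<n}. T $$ (a, c) * f (c, b)) + B $$ (a, b)
        - (f (a, b) * T $$ (b, b) + (\<Sum>c<b. f (a, c) * T $$ (c, b))) =
        T $$ (a, a) * f (a, b) - f (a, b) * T $$ (b, b) + rest f (a, b)"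
      by (simp add: rest_def algebra_simps)
    also have "\<dots> = 0"
      unfolding f[OF s] by simp
    finally show "(T * mat n n f + B - mat n n f * T) $$ (a, b) = 0" .
  qed
qed

section \<open>Block diagonal matrices\<close>

lemma diag_mat_diag_block_mat:
  assumes "\<forall>A\<in>set As. square_mat A"
  shows "diag_mat (diag_block_mat As) = concat (map diag_mat As)"
  using assms
proof (induction As)
  case Nil
  then show ?case by (simp add: diag_mat_def)
next
  case (Cons A As)
  then have "A \<in> carrier_mat (dim_row A) (dim_row A)"
    and "diag_block_mat As \<in> carrier_mat (dim_row (diag_block_mat As)) (dim_row (diag_block_mat As))"
    using diag_block_mat_square[of As] by auto
  note diag_four_block_mat[OF this]
  moreover have "dim_col A = dim_row A" "dim_col (diag_block_mat As) = dim_row (diag_block_mat As)"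
    using Cons.prems diag_block_mat_square[of As] by auto
  ultimately show ?case
    using Cons.IH Cons.prems by (simp add: Let_def)
qed

lemma diag_mat_index: "i < dim_row A \<Longrightarrow> A $$ (i, i) \<in> set (diag_mat A)"
  by (auto simp: diag_mat_def)

text \<open>The position of an index among the blocks is read off the diagonal: \<open>S\<close> relates
  diagonal entries of different blocks, so the last hypothesis makes \<open>M\<close> vanish outside the blocks
  without any arithmetic on block offsets. \<open>S\<close> is needed in both directions to cover the entries
  above and below the blocks.\<close>

lemma block_diagonal_if_zero_between_blocks:
  fixes As :: "'a :: zero mat list" and M :: "'b :: zero mat"
  assumes "\<forall>A\<in>set As. square_mat A"
    and "sorted_wrt (\<lambda>A B. \<forall>p\<in>set (diag_mat A). \<forall>q\<in>set (diag_mat B). S p q \<and> S q p) As"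
    and "M \<in> carrier_mat (sum_list (map dim_row As)) (sum_list (map dim_row As))"
    and "\<And>a b. a < dim_row M \<Longrightarrow> b < dim_row M \<Longrightarrow>
      S (diag_block_mat As $$ (a, a)) (diag_block_mat As $$ (b, b)) \<Longrightarrow> M $$ (a, b) = 0"
  shows "\<exists>Hs. list_all2 (\<lambda>A H. H \<in> carrier_mat (dim_row A) (dim_row A)) As Hs \<and>
    M = diag_block_mat Hs"
  using assms
proof (induction As arbitrary: M)
  case Nil
  then show ?case by auto
next
  case (Cons A As)
  define k where "k = dim_row A"
  define l where "l = sum_list (map dim_row As)"
  let ?D = "diag_block_mat As"
  have A: "A \<in> carrier_mat k k"
    using Cons.prems(1) by (auto simp: k_def)
  have D: "?D \<in> carrier_mat l l"
    using Cons.prems(1) diag_block_mat_square[of As] by (auto simp: l_def dim_diag_block_mat)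
  have M: "M \<in> carrier_mat (k + l) (k + l)"
    using Cons.prems(3) by (simp add: k_def l_def)
  have top: "diag_block_mat (A # As) $$ (a, a) = A $$ (a, a)" if "a < k" for a
    using that A D by (simp add: Let_def)
  have bot: "diag_block_mat (A # As) $$ (k + b, k + b) = ?D $$ (b, b)" if "b < l" for b
    using that A D by (simp add: Let_def)
  define H where "H = mat k k (\<lambda>(a, b). M $$ (a, b))"
  define N where "N = mat l l (\<lambda>(a, b). M $$ (k + a, k + b))"
  have "\<exists>Hs. list_all2 (\<lambda>A H. H \<in> carrier_mat (dim_row A) (dim_row A)) As Hs \<and>
      N = diag_block_mat Hs"
  proof (rule Cons.IH)
    show "N \<in> carrier_mat (sum_list (map dim_row As)) (sum_list (map dim_row As))"
      by (simp add: N_def l_def)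
    fix a b
    assume "a < dim_row N" "b < dim_row N" "S (?D $$ (a, a)) (?D $$ (b, b))"
    then show "N $$ (a, b) = 0"
      using Cons.prems(4)[of "k + a" "k + b"] M by (simp add: N_def bot del: diag_block_mat.simps)
  qed (use Cons.prems(1,2) in auto)
  then obtain Hs where Hs: "list_all2 (\<lambda>A H. H \<in> carrier_mat (dim_row A) (dim_row A)) As Hs"
    and N: "N = diag_block_mat Hs"
    by blast
  have S: "S (A $$ (a, a)) (?D $$ (b, b)) \<and> S (?D $$ (b, b)) (A $$ (a, a))"
    if "a < k" "b < l" for a b
  proof -
    have "A $$ (a, a) \<in> set (diag_mat A)" "?D $$ (b, b) \<in> set (diag_mat ?D)"
      using that A D by (auto intro: diag_mat_index)
    then show ?thesis
      using Cons.prems(1,2) by (auto simp: diag_mat_diag_block_mat)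
  qed
  have "M $$ (a, k + b) = 0" "M $$ (k + b, a) = 0" if "a < k" "b < l" for a b
    using Cons.prems(4)[of a "k + b"] Cons.prems(4)[of "k + b" a] S[OF that] that M
    by (simp_all add: top bot del: diag_block_mat.simps)
  note off = this
  have "M = four_block_mat H (0\<^sub>m k l) (0\<^sub>m l k) N"
  proof (rule eq_matI)
    fix a b
    assume "a < dim_row (four_block_mat H (0\<^sub>m k l) (0\<^sub>m l k) N)"
      "b < dim_col (four_block_mat H (0\<^sub>m k l) (0\<^sub>m l k) N)"
    then show "M $$ (a, b) = four_block_mat H (0\<^sub>m k l) (0\<^sub>m l k) N $$ (a, b)"
      using off[of a "b - k"] off[of b "a - k"] by (auto simp: H_def N_def)
  qed (use M in \<open>auto simp: H_def N_def\<close>)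
  also have "\<dots> = diag_block_mat (H # Hs)"
  proof -
    have "dim_row (diag_block_mat Hs) = l" "dim_col (diag_block_mat Hs) = l"
      by (simp_all add: N_def flip: N)
    then show ?thesis
      by (simp add: Let_def H_def N)
  qed
  finally have "M = diag_block_mat (H # Hs)" .
  moreover have "H \<in> carrier_mat (dim_row A) (dim_row A)"
    by (simp add: H_def k_def)
  ultimately show ?case
    using Hs by (intro exI[of _ "H # Hs"]) simp
qed

section \<open>Dual quaternion matrices\<close>

lemma dual_mat_dim [simp]:
  "dim_row (dual_mat A B) = dim_row B" "dim_col (dual_mat A B) = dim_col B"
  by (simp_all add: dual_mat_def)

lemma dual_mat_carrier [simp]:
  "B \<in> carrier_mat n k \<Longrightarrow> dual_mat A B \<in> carrier_mat n k"
  by (intro carrier_matI) simp_all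

lemma dual_mat_one: "dual_mat (1\<^sub>m n) (0\<^sub>m n n) = 1\<^sub>m n"
proof (rule eq_matI)
  fix i j
  assume "i < dim_row (1\<^sub>m n :: dquat mat)" "j < dim_col (1\<^sub>m n :: dquat mat)"
  then have ij: "i < n" "j < n"
    by simp_all
  have "dual_mat (1\<^sub>m n) (0\<^sub>m n n) $$ (i, j) = DQuat (1\<^sub>m n $$ (i, j)) (0\<^sub>m n n $$ (i, j))"
    using ij by (intro dual_mat_index) simp_all
  also have "\<dots> = 1\<^sub>m n $$ (i, j)"
    using ij by (simp add: zero_dquat_def one_dquat_def)
  finally show "dual_mat (1\<^sub>m n) (0\<^sub>m n n) $$ (i, j) = 1\<^sub>m n $$ (i, j)" .
qed simp_all

lemma sum_DQuat: "(\<Sum>i\<in>I. DQuat (f i) (g i)) = DQuat (sum f I) (sum g I)"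
proof (induction I rule: infinite_finite_induct)
  case (insert i I)
  then show ?case
    by (simp add: plus_dquat_def)
qed (simp_all flip: zero_dquat_def)

lemma dual_mat_mult:
  assumes "A \<in> carrier_mat n k" "A' \<in> carrier_mat n k" "B \<in> carrier_mat k l" "B' \<in> carrier_mat k l"
  shows "dual_mat A A' * dual_mat B B' = dual_mat (A * B) (A * B' + A' * B)"
proof (rule eq_matI)
  fix i j
  assume "i < dim_row (dual_mat (A * B) (A * B' + A' * B))"
    "j < dim_col (dual_mat (A * B) (A * B' + A' * B))"
  then have ij: "i < n" "j < l"
    using assms by auto
  have "(dual_mat A A' * dual_mat B B') $$ (i, j) =
      (\<Sum>c\<in>{0..<k}. dual_mat A A' $$ (i, c) * dual_mat B B' $$ (c, j))"
    using assms ij by (simp add: scalar_prod_def)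
  also have "\<dots> = (\<Sum>c\<in>{0..<k}. DQuat (A $$ (i, c) * B $$ (c, j))
      (A $$ (i, c) * B' $$ (c, j) + A' $$ (i, c) * B $$ (c, j)))"
    using assms ij by (intro sum.cong) (simp_all add: dual_mat_index times_dquat_def)
  also have "\<dots> = DQuat ((A * B) $$ (i, j)) ((A * B' + A' * B) $$ (i, j))"
    using assms ij by (simp add: sum_DQuat scalar_prod_def sum.distrib)
  also have "\<dots> = dual_mat (A * B) (A * B' + A' * B) $$ (i, j)"
    using assms ij by (intro dual_mat_index[symmetric]) auto
  finally show "(dual_mat A A' * dual_mat B B') $$ (i, j) =
      dual_mat (A * B) (A * B' + A' * B) $$ (i, j)" .
qed (use assms in simp_all)

lemma dual_mat_four_block_diag:
  assumes "A \<in> carrier_mat k k" "H \<in> carrier_mat k k" "B \<in> carrier_mat l l" "K \<in> carrier_mat l l"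
  shows "dual_mat (four_block_mat A (0\<^sub>m k l) (0\<^sub>m l k) B) (four_block_mat H (0\<^sub>m k l) (0\<^sub>m l k) K)
    = four_block_mat (dual_mat A H) (0\<^sub>m k l) (0\<^sub>m l k) (dual_mat B K)"
proof -
  have zero: "map_mat dquat_of_quat (0\<^sub>m r c) = 0\<^sub>m r c" "q \<cdot>\<^sub>m 0\<^sub>m r c = (0\<^sub>m r c :: dquat mat)" for q r c
    by (auto simp: dquat_of_quat_def zero_dquat_def intro!: eq_matI)
  show ?thesis
    unfolding dual_mat_def using assms
    by (simp add: map_four_block_mat[of _ k k _ l _ l] smult_four_block_mat[of _ k k _ l _ l]
        add_four_block_mat[of _ k k _ l _ l] zero)
qed

lemma dual_mat_diag_block_mat:
  assumes "list_all2 (\<lambda>A H. square_mat A \<and> H \<in> carrier_mat (dim_row A) (dim_row A)) As Hs"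
  shows "dual_mat (diag_block_mat As) (diag_block_mat Hs) = diag_block_mat (map2 dual_mat As Hs)"
proof -
  let ?n = "sum_list (map dim_row As)"
  have "diag_block_mat As \<in> carrier_mat ?n ?n \<and> diag_block_mat Hs \<in> carrier_mat ?n ?n \<and>
      dual_mat (diag_block_mat As) (diag_block_mat Hs) = diag_block_mat (map2 dual_mat As Hs)"
    using assms
  proof (induction rule: list_all2_induct)
    case Nil
    then show ?case by (auto intro!: eq_matI)
  next
    case (Cons A As H Hs)
    define k where "k = dim_row A"
    define l where "l = sum_list (map dim_row As)"
    have AH: "A \<in> carrier_mat k k" "H \<in> carrier_mat k k"
      using Cons.hyps by (auto simp: k_def)
    have D: "diag_block_mat As \<in> carrier_mat l l" "diag_block_mat Hs \<in> carrier_mat l l"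
      and IH: "diag_block_mat (map2 dual_mat As Hs) = dual_mat (diag_block_mat As) (diag_block_mat Hs)"
      using Cons.IH by (auto simp: l_def)
    have four: "diag_block_mat (A # As) = four_block_mat A (0\<^sub>m k l) (0\<^sub>m l k) (diag_block_mat As)"
      "diag_block_mat (H # Hs) = four_block_mat H (0\<^sub>m k l) (0\<^sub>m l k) (diag_block_mat Hs)"
      using AH D by (auto simp: Let_def)
    have "diag_block_mat (map2 dual_mat (A # As) (H # Hs)) =
        four_block_mat (dual_mat A H) (0\<^sub>m k l) (0\<^sub>m l k) (dual_mat (diag_block_mat As) (diag_block_mat Hs))"
      using AH D by (simp add: Let_def IH)
    also have "\<dots> = dual_mat (diag_block_mat (A # As)) (diag_block_mat (H # Hs))"
      unfolding four by (rule dual_mat_four_block_diag[symmetric]) (fact AH D)+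
    moreover have "diag_block_mat (A # As) \<in> carrier_mat (k + l) (k + l)"
      "diag_block_mat (H # Hs) \<in> carrier_mat (k + l) (k + l)"
      unfolding four using AH D by auto
    ultimately show ?case
      by (simp add: k_def l_def del: diag_block_mat.simps)
  qed
  then show ?thesis by blast
qed

text \<open>Here $P' = P(1 + X\epsilon)$ and $Q' = (1 - X\epsilon)Q$ with $Q = P^{-1}$.\<close>

lemma dual_mat_conjugate:
  assumes "A \<in> carrier_mat n n" "B \<in> carrier_mat n n" "X \<in> carrier_mat n n"
    and "P \<in> carrier_mat n n" "Q \<in> carrier_mat n n" "P * Q = 1\<^sub>m n" "Q * P = 1\<^sub>m n"
  defines "P' \<equiv> dual_mat P (P * X)" and "Q' \<equiv> dual_mat Q (- (X * Q))"
  shows "P' * Q' = 1\<^sub>m n" "Q' * P' = 1\<^sub>m n"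
    and "Q' * dual_mat A B * P' =
      dual_mat (Q * A * P) (Q * A * P * X + Q * B * P - X * (Q * A * P))"
proof -
  note [simp] = assms(1-7)
  note [simp] = assms(1-5)[THEN carrier_matD(1)] assms(1-5)[THEN carrier_matD(2)]
  note [simp] = mult_carrier_mat[of _ n n _ n]
  note assoc = assoc_mult_mat[of _ n n _ n _ n]
  have "P * (X * Q) = P * X * Q"
    by (simp add: assoc)
  then have "P * (- (X * Q)) + P * X * Q = 0\<^sub>m n n"
    by (simp add: uminus_l_inv_mat[where nr = n and nc = n])
  then show "P' * Q' = 1\<^sub>m n"
    by (simp add: P'_def Q'_def dual_mat_mult[of _ n n _ _ n] dual_mat_one)
  have "Q * (P * X) = X"
    by (simp flip: assoc)
  moreover have "X * Q * P = X"
    by (simp add: assoc)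
  ultimately have "Q * (P * X) + - (X * Q) * P = 0\<^sub>m n n"
    by (intro eq_matI) auto
  then show "Q' * P' = 1\<^sub>m n"
    by (simp add: P'_def Q'_def dual_mat_mult[of _ n n _ _ n] dual_mat_one)
  have "Q * A * (P * X) + (Q * B + - (X * Q) * A) * P
      = Q * A * P * X + (Q * B * P + - (X * Q * A * P))"
    by (simp add: add_mult_distrib_mat[of _ n n _ _ n] assoc)
  also have "X * Q * A * P = X * (Q * A * P)"
    by (simp add: assoc)
  also have "Q * A * P * X + (Q * B * P + - (X * (Q * A * P)))
      = Q * A * P * X + Q * B * P - X * (Q * A * P)"
    by (simp add: minus_add_uminus_mat[of _ n n] assoc_add_mat[of _ n n])
  finally show "Q' * dual_mat A B * P' =
      dual_mat (Q * A * P) (Q * A * P * X + Q * B * P - X * (Q * A * P))"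
    by (simp add: P'_def Q'_def dual_mat_mult[of _ n n _ _ n])
qed

section \<open>Jordan matrices and block diagonalization\<close>

lemma diag_mat_jordan_matrix: "set (diag_mat (jordan_matrix bs)) \<subseteq> snd ` set bs"
proof (induction bs)
  case Nil
  then show ?case by (simp add: jordan_matrix_def diag_mat_def)
next
  case (Cons b bs)
  have "set (diag_mat (jordan_block (fst b) (snd b))) \<subseteq> {snd b}"
    by (auto simp: diag_mat_def)
  then show ?case
    using Cons by (cases b) (auto simp: jordan_matrix_Cons diag_four_block_mat[of _ "fst b" _ "sum_list (map fst bs)"])
qed

lemma is_jordan_partD:
  assumes "is_jordan_part A z J"
  shows "upper_triangular J" "square_mat J" "set (diag_mat J) \<subseteq> {quat_of_complex z}"
proof -
  obtain bs where J: "J = jordan_matrix (map (\<lambda>(k, z). (k, quat_of_complex z)) (filter (\<lambda>b. snd b = z) bs))"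
    using assms by (auto simp: is_jordan_part_def quat_jordan_matrix_def)
  show "upper_triangular J"
    unfolding J by (intro upper_triangularI jordan_matrix_upper_triangular) simp_all
  show "square_mat J"
    by (simp add: J)
  show "set (diag_mat J) \<subseteq> {quat_of_complex z}"
    unfolding J by (rule order_trans[OF diag_mat_jordan_matrix]) auto
qed

theorem theorem3p3:
  fixes n m :: nat
    and A\<^sub>s A\<^sub>d P\<^sub>s P\<^sub>s_inv :: "quat mat"
    and lam :: "nat \<Rightarrow> complex"
    and ns :: "nat \<Rightarrow> nat"
    and J :: "nat \<Rightarrow> quat mat"
  assumes "A\<^sub>s \<in> carrier_mat n n" and "A\<^sub>d \<in> carrier_mat n n"
    and "inj_on lam {..<m}"
    and "lam ` {..<m} = {z. standard_eigenvalue A\<^sub>s z}"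
    and "\<And>i. i < m \<Longrightarrow> ns i = algebraic_multiplicity A\<^sub>s (lam i)"
    and "\<And>i. i < m \<Longrightarrow> J i \<in> carrier_mat (ns i) (ns i)"
    and "\<And>i. i < m \<Longrightarrow> is_jordan_part A\<^sub>s (lam i) (J i)"
    and "P\<^sub>s \<in> carrier_mat n n" and "P\<^sub>s_inv \<in> carrier_mat n n"
    and "inverts_mat P\<^sub>s P\<^sub>s_inv" and "inverts_mat P\<^sub>s_inv P\<^sub>s"
    and "P\<^sub>s_inv * A\<^sub>s * P\<^sub>s = diag_block_mat (map J [0..<m])"
  shows "\<exists>P\<^sub>d \<in> carrier_mat n n. \<exists>P_inv \<in> carrier_mat n n. \<exists>H :: nat \<Rightarrow> quat mat.
      inverts_mat (dual_mat P\<^sub>s P\<^sub>d) P_inv \<and> inverts_mat P_inv (dual_mat P\<^sub>s P\<^sub>d) \<and>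
      (\<forall>i<m. H i \<in> carrier_mat (ns i) (ns i)) \<and>
      P_inv * dual_mat A\<^sub>s A\<^sub>d * dual_mat P\<^sub>s P\<^sub>d =
        diag_block_mat (map (\<lambda>i. dual_mat (J i) (H i)) [0..<m])"
proof -
  define Js where "Js = map J [0..<m]"
  define T where "T = diag_block_mat Js"
  define B where "B = P\<^sub>s_inv * A\<^sub>d * P\<^sub>s"
  let ?S = "\<lambda>p q :: quat. surj (\<lambda>x. p * x - x * q)"
  have T_eq: "P\<^sub>s_inv * A\<^sub>s * P\<^sub>s = T"
    using assms(12) by (simp add: T_def Js_def)
  have T: "T \<in> carrier_mat n n"
    using assms(1,8,9) by (simp flip: T_eq)
  have B: "B \<in> carrier_mat n n"
    using assms(2,8,9) by (simp add: B_def)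
  have square: "\<forall>A\<in>set Js. square_mat A"
    using is_jordan_partD(2)[OF assms(7)] by (auto simp: Js_def)
  have "upper_triangular T"
    unfolding T_def
    by (intro upper_triangularI diag_block_upper_triangular[OF _ square])
      (use upper_triangularD[OF is_jordan_partD(1)[OF assms(7)]] in \<open>auto simp: Js_def\<close>)
  from upper_triangular_commutator_eliminates[OF T this B]
  obtain X where X: "X \<in> carrier_mat n n"
    and elim: "\<And>a b. a < n \<Longrightarrow> b < n \<Longrightarrow> ?S (T $$ (a, a)) (T $$ (b, b)) \<Longrightarrow>
      (T * X + B - X * T) $$ (a, b) = 0"
    by blast
  have Im: "Im (lam i) \<ge> 0" if "i < m" for i
    using assms(4) that by (auto simp: standard_eigenvalue_def)
  have S: "?S p q"
    if "i < m" "j < m" "i \<noteq> j" "p \<in> set (diag_mat (J i))" "q \<in> set (diag_mat (J j))" for i j p q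
  proof -
    have "p = quat_of_complex (lam i)" "q = quat_of_complex (lam j)"
      using that is_jordan_partD(3)[OF assms(7)] by blast+
    moreover have "lam i \<noteq> lam j"
      using that assms(3) by (auto dest: inj_onD)
    ultimately show ?thesis
      using that by (simp add: surj_sylvester_upper_half_plane Im)
  qed
  \<comment> \<open>Diagonal entries of different blocks are distinct standard eigenvalues.\<close>
  have sep: "sorted_wrt (\<lambda>A B. \<forall>p\<in>set (diag_mat A). \<forall>q\<in>set (diag_mat B). ?S p q \<and> ?S q p) Js"
    unfolding sorted_wrt_iff_nth_less
  proof (intro allI impI ballI conjI)
    fix i j p q
    assume "i < j" "j < length Js" "p \<in> set (diag_mat (Js ! i))" "q \<in> set (diag_mat (Js ! j))"
    then have "i < m" "j < m" "i \<noteq> j" "p \<in> set (diag_mat (J i))" "q \<in> set (diag_mat (J j))"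
      by (simp_all add: Js_def)
    then show "?S p q" "?S q p"
      using S[of i j p q] S[of j i q p] by simp_all
  qed
  have n: "n = sum_list (map dim_row Js)"
    using T by (auto simp: T_def dim_diag_block_mat)
  have "\<exists>Hs. list_all2 (\<lambda>A H. H \<in> carrier_mat (dim_row A) (dim_row A)) Js Hs \<and>
      T * X + B - X * T = diag_block_mat Hs"
  proof (rule block_diagonal_if_zero_between_blocks[OF square sep])
    show "T * X + B - X * T \<in> carrier_mat (sum_list (map dim_row Js)) (sum_list (map dim_row Js))"
      unfolding n[symmetric] using T X B by (intro minus_carrier_mat mult_carrier_mat)
  qed (use elim T X B in \<open>auto simp flip: T_def\<close>)
  then obtain Hs where Hs: "list_all2 (\<lambda>A H. H \<in> carrier_mat (dim_row A) (dim_row A)) Js Hs"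
    and D: "T * X + B - X * T = diag_block_mat Hs"
    by blast
  have inv: "P\<^sub>s * P\<^sub>s_inv = 1\<^sub>m n" "P\<^sub>s_inv * P\<^sub>s = 1\<^sub>m n"
    using assms(8-11) by (auto simp: inverts_mat_def)
  note conj = dual_mat_conjugate[OF assms(1,2) X assms(8,9) inv, unfolded T_eq, folded B_def]
  have len: "length Hs = m"
    using list_all2_lengthD[OF Hs] by (simp add: Js_def)
  have "map2 dual_mat Js Hs = map (\<lambda>i. dual_mat (J i) (Hs ! i)) [0..<m]"
    by (rule nth_equalityI) (simp_all add: Js_def len)
  moreover have "dual_mat T (diag_block_mat Hs) = diag_block_mat (map2 dual_mat Js Hs)"
    unfolding T_def by (rule dual_mat_diag_block_mat)
      (use Hs square in \<open>auto simp: list_all2_conv_all_nth\<close>)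
  ultimately have "dual_mat P\<^sub>s_inv (- (X * P\<^sub>s_inv)) * dual_mat A\<^sub>s A\<^sub>d * dual_mat P\<^sub>s (P\<^sub>s * X) =
      diag_block_mat (map (\<lambda>i. dual_mat (J i) (Hs ! i)) [0..<m])"
    by (simp add: conj(3) D)
  moreover have "\<forall>i<m. Hs ! i \<in> carrier_mat (ns i) (ns i)"
    using Hs carrier_matD(1)[OF assms(6)] by (simp add: list_all2_conv_all_nth Js_def)
  ultimately show ?thesis
    using conj(1,2) assms(8,9) X
    by (intro bexI[of _ "P\<^sub>s * X"] bexI[of _ "dual_mat P\<^sub>s_inv (- (X * P\<^sub>s_inv))"]
        exI[of _ "\<lambda>i. Hs ! i"]) (auto simp: inverts_mat_def)
qed

end
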